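(* Let $\mathcal C$ be an essentially small category, $T$ the class of sieves $C\hookrightarrow y(X)$ on objects of $\mathcal C$, $S$ the class of embeddings $Q\hookrightarrow P$ of a sub-presheaf in a presheaf on $\mathcal C$, $R\subseteq T\times S$ the duality relation between sieves and sub-presheaves, and $$F_R:(\mathcal P(T),\subseteq)\to(\mathcal P(S),\supseteq),\qquad G_R:(\mathcal P(S),\supseteq)\to(\mathcal P(T),\subseteq)$$ the adjoint pair of order-preserving maps defined by $R$ (all defined in the context). Then: (i) A subclass $J\subseteq T$ is a fixed point of $G_R\circ F_R$ if and only if it is a Grothendieck topology. (ii) A subclass $I\subseteq S$ is a fixed point of $F_R\circ G_R$ if and only if it is a "closure property", in the sense that it satisfies: (1) the equalities $Q=P$ are elements of $I$; (2) for every morphism $P'\to P$ of $\widehat{\mathcal C}$, base change along it sends sub-presheaves $Q\hookrightarrow P$ that are elements of $I$ to sub-presheaves $Q\times_PP'\hookrightarrow P'$ that are elements of $I$; (3) for every family of sub-presheaves $Q_k\hookrightarrow P$, $k\in K$, of the same presheaf that are elements of $I$, their intersection $\bigcap_{k\in K}Q_k\hookrightarrow P$ is again an element of $I$; (4) if, for every sub-presheaf $Q\hookrightarrow P$, one denotes by $\overline Q\hookrightarrow P$ the smallest sub-presheaf of $P$ that contains $Q$ and is an element of $I$, then for every morphism $P'\to P$ one has $\overline{P'\times_PQ}=P'\times_P\overline Q$.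
   Context: $\widehat{\mathcal C}=[\mathcal C^{\rm op},{\rm Set}]$, $y$ is the Yoneda embedding; a sieve on $X$ is a sub-presheaf $C\hookrightarrow y(X)$; for $x:X'\to X$, $x^*C=C\times_{y(X)}y(X')$. An embedding of presheaves $Q\hookrightarrow P$ is a monomorphism such that each component $Q(X)\hookrightarrow P(X)$ is the inclusion of a subset. $\mathcal P(\cdot)$ denotes the collection of subclasses. The relation $R\subseteq T\times S$ consists of the pairs $(C\hookrightarrow y(X),\,Q\hookrightarrow P)$ such that, for every morphism $x:X'\to X$ of $\mathcal C$ and every $p\in P(X')$, one has $p\in Q(X')$ as soon as every morphism $(x':X''\to X')\in x^*C$ sends $p$ into the subset $Q(X'')\subseteq P(X'')$. The associated maps are $$F_R(J)=\{s\in S\mid(t,s)\in R\ \forall t\in J\},\qquad G_R(I)=\{t\in T\mid(t,s)\in R\ \forall s\in I\}.$$ A Grothendieck topology is viewed as the class of its covering sieves. *)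

theory Defs
  imports "HOL-Library.FuncSet" "HOL-Library.Nat_Bijection"
begin

section \<open>The universe of sets\<close>

text \<open>
  The category Set is formed inside a type \<open>'v\<close> of sets with membership \<open>x \<in> elts y\<close>.
  A ``class'' is then an arbitrary HOL set, and a HOL set of elements of \<open>'v\<close> is a ``set''
  (it is small) iff it is of the form \<open>elts x\<close>. The axioms are those of ZF with separation and
  replacement for arbitrary classes and class functions. Infinity is left out: nothing depends on
  it, the usual universes are covered, and the axioms stay satisfiable in HOL.
\<close>

locale universe =
  fixes elts :: "'v \<Rightarrow> 'v set"
  assumes extensionality: "inj elts"
    and foundation: "wf {(x, y). x \<in> elts y}"
    and separation: "A \<subseteq> elts x \<Longrightarrow> \<exists>z. elts z = A"
    and pairing: "\<exists>z. elts z = {x, y}"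
    and union: "\<exists>z. elts z = (\<Union>y\<in>elts x. elts y)"
    and powerset: "\<exists>z. elts z = {y. elts y \<subseteq> elts x}"
    and replacement: "\<exists>z. elts z = f ` elts x"

definition small :: "('v \<Rightarrow> 'v set) \<Rightarrow> 'v set \<Rightarrow> bool" where
  "small elts A \<longleftrightarrow> (\<exists>x. elts x = A)"

text \<open>The hereditarily finite sets, in Ackermann's coding by natural numbers, form a universe.\<close>

lemma universe_hereditarily_finite: "universe set_decode"
proof -
  have fin: "\<exists>z. set_decode z = A" if "finite A" for A
    using set_encode_inverse[OF that] by blast
  have less: "x < y" if "x \<in> set_decode y" for x y
  proof (rule ccontr)
    assume "\<not> x < y"
    then have "y < 2 ^ x" by (intro le_less_trans[OF _ less_exp]) linarith
    then have "y div 2 ^ x = 0" by (rule div_less)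
    with that show False by (simp add: set_decode_def)
  qed
  show ?thesis
  proof (rule universe.intro)
    show "inj set_decode" by (rule inj_on_inverseI[where g = set_encode]) (rule set_decode_inverse)
    show "wf {(x, y). x \<in> set_decode y}"
      by (rule wf_subset[OF wf_less]) (blast intro: less)
  next
    fix A x assume "A \<subseteq> set_decode x"
    then show "\<exists>z. set_decode z = A"
      by (rule fin[OF finite_subset]) (rule finite_set_decode)
  next
    fix x y :: nat
    show "\<exists>z. set_decode z = {x, y}" by (rule fin) simp
  next
    fix x
    show "\<exists>z. set_decode z = (\<Union>y\<in>set_decode x. set_decode y)"
      by (rule fin) (intro finite_UN_I finite_set_decode)
  next
    fix x
    have "{y. set_decode y \<subseteq> set_decode x} \<subseteq> set_encode ` Pow (set_decode x)"
    proof
      fix y assume "y \<in> {y. set_decode y \<subseteq> set_decode x}"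
      then have "set_encode (set_decode y) \<in> set_encode ` Pow (set_decode x)" by blast
      then show "y \<in> set_encode ` Pow (set_decode x)" by (simp only: set_decode_inverse)
    qed
    moreover have "finite (set_encode ` Pow (set_decode x))"
      by (intro finite_imageI finite_Pow_iff[THEN iffD2] finite_set_decode)
    ultimately show "\<exists>z. set_decode z = {y. set_decode y \<subseteq> set_decode x}"
      by (rule fin[OF finite_subset])
  next
    fix f :: "nat \<Rightarrow> nat" and x
    show "\<exists>z. set_decode z = f ` set_decode x"
      by (rule fin) (intro finite_imageI finite_set_decode)
  qed
qed


section \<open>Categories\<close>

record ('o, 'a) category_data =
  Ob :: "'o set"
  Ar :: "'a set"
  src :: "'a \<Rightarrow> 'o"
  tgt :: "'a \<Rightarrow> 'o"
  ident :: "'o \<Rightarrow> 'a"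
  cmp :: "'a \<Rightarrow> 'a \<Rightarrow> 'a"

definition homset :: "('o, 'a) category_data \<Rightarrow> 'o \<Rightarrow> 'o \<Rightarrow> 'a set" where
  "homset C X Y = {f \<in> Ar C. src C f = X \<and> tgt C f = Y}"

text \<open>\<open>cmp C g f\<close> is the composite of \<open>g\<close> after \<open>f\<close>.\<close>

locale category =
  fixes C :: "('o, 'a) category_data"
  assumes src_in: "f \<in> Ar C \<Longrightarrow> src C f \<in> Ob C"
    and tgt_in: "f \<in> Ar C \<Longrightarrow> tgt C f \<in> Ob C"
    and ident_in: "X \<in> Ob C \<Longrightarrow> ident C X \<in> homset C X X"
    and cmp_in: "f \<in> homset C X Y \<Longrightarrow> g \<in> homset C Y Z \<Longrightarrow> cmp C g f \<in> homset C X Z"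
    and cmp_ident_right: "f \<in> homset C X Y \<Longrightarrow> cmp C f (ident C X) = f"
    and cmp_ident_left: "f \<in> homset C X Y \<Longrightarrow> cmp C (ident C Y) f = f"
    and cmp_assoc: "f \<in> homset C W X \<Longrightarrow> g \<in> homset C X Y \<Longrightarrow> h \<in> homset C Y Z \<Longrightarrow>
      cmp C h (cmp C g f) = cmp C (cmp C h g) f"

definition isomorphism :: "('o, 'a) category_data \<Rightarrow> 'o \<Rightarrow> 'o \<Rightarrow> 'a \<Rightarrow> bool" where
  "isomorphism C X Y f \<longleftrightarrow> f \<in> homset C X Y \<and>
     (\<exists>g\<in>homset C Y X. cmp C g f = ident C X \<and> cmp C f g = ident C Y)"

record ('o, 'a, 'p, 'b) functor_data =
  omap :: "'o \<Rightarrow> 'p"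
  amap :: "'a \<Rightarrow> 'b"

definition is_functor ::
  "('o, 'a) category_data \<Rightarrow> ('p, 'b) category_data \<Rightarrow> ('o, 'a, 'p, 'b) functor_data \<Rightarrow> bool" where
  "is_functor A B F \<longleftrightarrow>
     (\<forall>X\<in>Ob A. omap F X \<in> Ob B) \<and>
     (\<forall>f\<in>Ar A. amap F f \<in> homset B (omap F (src A f)) (omap F (tgt A f))) \<and>
     (\<forall>X\<in>Ob A. amap F (ident A X) = ident B (omap F X)) \<and>
     (\<forall>f\<in>Ar A. \<forall>g\<in>Ar A. src A g = tgt A f \<longrightarrow>
        amap F (cmp A g f) = cmp B (amap F g) (amap F f))"

definition functor_id :: "('o, 'a, 'o, 'a) functor_data" where
  "functor_id = \<lparr>omap = (\<lambda>X. X), amap = (\<lambda>f. f)\<rparr>"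

definition functor_comp ::
  "('p, 'b, 'q, 'c) functor_data \<Rightarrow> ('o, 'a, 'p, 'b) functor_data \<Rightarrow> ('o, 'a, 'q, 'c) functor_data" where
  "functor_comp G F = \<lparr>omap = omap G \<circ> omap F, amap = amap G \<circ> amap F\<rparr>"

definition natural_isomorphism ::
  "('o, 'a) category_data \<Rightarrow> ('p, 'b) category_data \<Rightarrow> ('o, 'a, 'p, 'b) functor_data \<Rightarrow>
   ('o, 'a, 'p, 'b) functor_data \<Rightarrow> ('o \<Rightarrow> 'b) \<Rightarrow> bool" where
  "natural_isomorphism A B F G \<eta> \<longleftrightarrow>
     (\<forall>X\<in>Ob A. isomorphism B (omap F X) (omap G X) (\<eta> X)) \<and>
     (\<forall>f\<in>Ar A. cmp B (amap G f) (\<eta> (src A f)) = cmp B (\<eta> (tgt A f)) (amap F f))"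

definition equivalent_categories ::
  "('o, 'a) category_data \<Rightarrow> ('p, 'b) category_data \<Rightarrow> bool" where
  "equivalent_categories A B \<longleftrightarrow>
     (\<exists>F G \<eta> \<epsilon>. is_functor A B F \<and> is_functor B A G \<and>
        natural_isomorphism A A functor_id (functor_comp G F) \<eta> \<and>
        natural_isomorphism B B (functor_comp F G) functor_id \<epsilon>)"

text \<open>
  The morphisms of \<open>C\<close> are themselves elements of the universe, so that the values
  \<open>homset C X' X\<close> of the representable presheaves are sets without further encoding.
\<close>

definition essentially_small_category ::
  "('v \<Rightarrow> 'v set) \<Rightarrow> ('o, 'v) category_data \<Rightarrow> bool" where
  "essentially_small_category elts C \<longleftrightarrow> category C \<and>
     (\<exists>D :: ('v, 'v) category_data.
        category D \<and> small elts (Ob D) \<and> small elts (Ar D) \<and> equivalent_categories D C)"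


section \<open>Presheaves\<close>

text \<open>
  All functions involved are extensional (equal to \<open>undefined\<close> outside their domain), so
  that HOL equality of presheaves is equality of presheaves. \<open>act P f p\<close> is the image of \<open>p\<close>
  under \<open>P(f)\<close>.
\<close>

record ('o, 'v) presheaf_data =
  sec :: "'o \<Rightarrow> 'v set"
  act :: "'v \<Rightarrow> 'v \<Rightarrow> 'v"

definition presheaf ::
  "('v \<Rightarrow> 'v set) \<Rightarrow> ('o, 'v) category_data \<Rightarrow> ('o, 'v) presheaf_data \<Rightarrow> bool" where
  "presheaf elts C P \<longleftrightarrow>
     sec P \<in> Ob C \<rightarrow>\<^sub>E {A. small elts A} \<and>
     act P \<in> (\<Pi>\<^sub>E f\<in>Ar C. sec P (tgt C f) \<rightarrow>\<^sub>E sec P (src C f)) \<and>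
     (\<forall>X\<in>Ob C. \<forall>p\<in>sec P X. act P (ident C X) p = p) \<and>
     (\<forall>f\<in>Ar C. \<forall>g\<in>Ar C. src C g = tgt C f \<longrightarrow>
        (\<forall>p\<in>sec P (tgt C g). act P (cmp C g f) p = act P f (act P g p)))"

definition presheaf_morphism ::
  "('o, 'v) category_data \<Rightarrow> ('o, 'v) presheaf_data \<Rightarrow> ('o, 'v) presheaf_data \<Rightarrow>
   ('o \<Rightarrow> 'v \<Rightarrow> 'v) \<Rightarrow> bool" where
  "presheaf_morphism C P' P \<phi> \<longleftrightarrow>
     \<phi> \<in> (\<Pi>\<^sub>E X\<in>Ob C. sec P' X \<rightarrow>\<^sub>E sec P X) \<and>
     (\<forall>f\<in>Ar C. \<forall>p\<in>sec P' (tgt C f). \<phi> (src C f) (act P' f p) = act P f (\<phi> (tgt C f) p))"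

text \<open>An embedding of \<open>Q\<close> in \<open>P\<close>: the inclusions \<open>Q(X) \<subseteq> P(X)\<close> form a morphism of presheaves.\<close>

definition embedding ::
  "('v \<Rightarrow> 'v set) \<Rightarrow> ('o, 'v) category_data \<Rightarrow>
   ('o, 'v) presheaf_data \<Rightarrow> ('o, 'v) presheaf_data \<Rightarrow> bool" where
  "embedding elts C Q P \<longleftrightarrow> presheaf elts C Q \<and> presheaf elts C P \<and>
     (\<forall>X\<in>Ob C. sec Q X \<subseteq> sec P X) \<and>
     (\<forall>f\<in>Ar C. \<forall>q\<in>sec Q (tgt C f). act Q f q = act P f q)"

text \<open>The sub-presheaf of \<open>P\<close> with values \<open>A X\<close>, for \<open>A\<close> stable under the action of \<open>P\<close>.\<close>

definition subpresheaf_on ::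
  "('o, 'v) category_data \<Rightarrow> ('o, 'v) presheaf_data \<Rightarrow> ('o \<Rightarrow> 'v set) \<Rightarrow>
   ('o, 'v) presheaf_data" where
  "subpresheaf_on C P A =
     \<lparr>sec = (\<lambda>X\<in>Ob C. A X), act = (\<lambda>f\<in>Ar C. \<lambda>p\<in>A (tgt C f). act P f p)\<rparr>"

text \<open>The fibre product of \<open>Q\<close> and \<open>P'\<close> over \<open>P\<close> as a sub-presheaf of \<open>P'\<close>, for \<open>\<phi> : P' \<rightarrow> P\<close>.\<close>

definition base_change ::
  "('o, 'v) category_data \<Rightarrow> ('o, 'v) presheaf_data \<Rightarrow> ('o \<Rightarrow> 'v \<Rightarrow> 'v) \<Rightarrow>
   ('o, 'v) presheaf_data \<Rightarrow> ('o, 'v) presheaf_data" where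
  "base_change C P' \<phi> Q = subpresheaf_on C P' (\<lambda>X. {p \<in> sec P' X. \<phi> X p \<in> sec Q X})"

text \<open>Intersection within \<open>P\<close>; it is \<open>P\<close> itself for the empty family.\<close>

definition intersection ::
  "('o, 'v) category_data \<Rightarrow> ('o, 'v) presheaf_data \<Rightarrow> 'k set \<Rightarrow>
   ('k \<Rightarrow> ('o, 'v) presheaf_data) \<Rightarrow> ('o, 'v) presheaf_data" where
  "intersection C P K Q = subpresheaf_on C P (\<lambda>X. {p \<in> sec P X. \<forall>k\<in>K. p \<in> sec (Q k) X})"

definition yoneda :: "('o, 'v) category_data \<Rightarrow> 'o \<Rightarrow> ('o, 'v) presheaf_data" where
  "yoneda C X =
     \<lparr>sec = (\<lambda>X'\<in>Ob C. homset C X' X),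
      act = (\<lambda>f\<in>Ar C. \<lambda>g\<in>homset C (tgt C f) X. cmp C g f)\<rparr>"

definition yoneda_map :: "('o, 'v) category_data \<Rightarrow> 'v \<Rightarrow> 'o \<Rightarrow> 'v \<Rightarrow> 'v" where
  "yoneda_map C x = (\<lambda>X''\<in>Ob C. \<lambda>x'\<in>homset C X'' (src C x). cmp C x x')"


section \<open>Sieves, sub-presheaves and their duality\<close>

type_synonym ('o, 'v) sieve = "'o \<times> ('o, 'v) presheaf_data"
type_synonym ('o, 'v) subpresheaf = "('o, 'v) presheaf_data \<times> ('o, 'v) presheaf_data"

definition sieves :: "('v \<Rightarrow> 'v set) \<Rightarrow> ('o, 'v) category_data \<Rightarrow> ('o, 'v) sieve set" where
  "sieves elts C = {(X, D). X \<in> Ob C \<and> embedding elts C D (yoneda C X)}"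

definition subpresheaves ::
  "('v \<Rightarrow> 'v set) \<Rightarrow> ('o, 'v) category_data \<Rightarrow> ('o, 'v) subpresheaf set" where
  "subpresheaves elts C = {(Q, P). embedding elts C Q P}"

definition sieve_pullback ::
  "('o, 'v) category_data \<Rightarrow> 'v \<Rightarrow> ('o, 'v) presheaf_data \<Rightarrow> ('o, 'v) presheaf_data" where
  "sieve_pullback C x D = base_change C (yoneda C (src C x)) (yoneda_map C x) D"

definition duality ::
  "('v \<Rightarrow> 'v set) \<Rightarrow> ('o, 'v) category_data \<Rightarrow> (('o, 'v) sieve \<times> ('o, 'v) subpresheaf) set" where
  "duality elts C = {((X, D), (Q, P)).
     (X, D) \<in> sieves elts C \<and> (Q, P) \<in> subpresheaves elts C \<and>
     (\<forall>X'\<in>Ob C. \<forall>x\<in>homset C X' X. \<forall>p\<in>sec P X'.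
        (\<forall>X''\<in>Ob C. \<forall>x'\<in>sec (sieve_pullback C x D) X''. act P x' p \<in> sec Q X'') \<longrightarrow>
        p \<in> sec Q X')}"

definition F_dual ::
  "('v \<Rightarrow> 'v set) \<Rightarrow> ('o, 'v) category_data \<Rightarrow> ('o, 'v) sieve set \<Rightarrow> ('o, 'v) subpresheaf set" where
  "F_dual elts C J = {s \<in> subpresheaves elts C. \<forall>t\<in>J. (t, s) \<in> duality elts C}"

definition G_dual ::
  "('v \<Rightarrow> 'v set) \<Rightarrow> ('o, 'v) category_data \<Rightarrow> ('o, 'v) subpresheaf set \<Rightarrow> ('o, 'v) sieve set" where
  "G_dual elts C I = {t \<in> sieves elts C. \<forall>s\<in>I. (t, s) \<in> duality elts C}"

lemma F_dual_G_dual_adjoint: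
  assumes "J \<subseteq> sieves elts C" and "I \<subseteq> subpresheaves elts C"
  shows "F_dual elts C J \<supseteq> I \<longleftrightarrow> J \<subseteq> G_dual elts C I"
  using assms by (auto simp: F_dual_def G_dual_def)

definition grothendieck_topology ::
  "('v \<Rightarrow> 'v set) \<Rightarrow> ('o, 'v) category_data \<Rightarrow> ('o, 'v) sieve set \<Rightarrow> bool" where
  "grothendieck_topology elts C J \<longleftrightarrow> J \<subseteq> sieves elts C \<and>
     (\<forall>X\<in>Ob C. (X, yoneda C X) \<in> J) \<and>
     (\<forall>X D X' x. (X, D) \<in> J \<and> x \<in> homset C X' X \<longrightarrow> (X', sieve_pullback C x D) \<in> J) \<and>
     (\<forall>X D D'. (X, D) \<in> J \<and> (X, D') \<in> sieves elts C \<and>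
        (\<forall>X'\<in>Ob C. \<forall>x\<in>sec D X'. (X', sieve_pullback C x D') \<in> J) \<longrightarrow> (X, D') \<in> J)"

definition smallest_above ::
  "('v \<Rightarrow> 'v set) \<Rightarrow> ('o, 'v) category_data \<Rightarrow> ('o, 'v) subpresheaf set \<Rightarrow>
   ('o, 'v) presheaf_data \<Rightarrow> ('o, 'v) presheaf_data \<Rightarrow> ('o, 'v) presheaf_data \<Rightarrow> bool" where
  "smallest_above elts C I P Q R \<longleftrightarrow>
     (R, P) \<in> I \<and> embedding elts C Q R \<and>
     (\<forall>R'. (R', P) \<in> I \<and> embedding elts C Q R' \<longrightarrow> embedding elts C R R')"

text \<open>
  There is at most one such sub-presheaf, and one does exist if \<open>I\<close> is stable under
  intersections. Only in that case is \<open>closure_in\<close> used.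
\<close>

definition closure_in ::
  "('v \<Rightarrow> 'v set) \<Rightarrow> ('o, 'v) category_data \<Rightarrow> ('o, 'v) subpresheaf set \<Rightarrow>
   ('o, 'v) presheaf_data \<Rightarrow> ('o, 'v) presheaf_data \<Rightarrow> ('o, 'v) presheaf_data" where
  "closure_in elts C I P Q = (THE R. smallest_above elts C I P Q R)"

definition closure_property ::
  "('v \<Rightarrow> 'v set) \<Rightarrow> ('o, 'v) category_data \<Rightarrow> ('o, 'v) subpresheaf set \<Rightarrow> bool" where
  "closure_property elts C I \<longleftrightarrow>
     (\<forall>P. presheaf elts C P \<longrightarrow> (P, P) \<in> I) \<and>
     (\<forall>P' P \<phi> Q. presheaf elts C P' \<and> presheaf elts C P \<and> presheaf_morphism C P' P \<phi> \<and>
        (Q, P) \<in> I \<longrightarrow> (base_change C P' \<phi> Q, P') \<in> I) \<and>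
     (\<forall>P K Q. presheaf elts C P \<and> (\<forall>k\<in>elts K. (Q k, P) \<in> I) \<longrightarrow>
        (intersection C P (elts K) Q, P) \<in> I) \<and>
     (\<forall>P' P \<phi> Q. presheaf elts C P' \<and> presheaf elts C P \<and> presheaf_morphism C P' P \<phi> \<and>
        embedding elts C Q P \<longrightarrow>
        closure_in elts C I P' (base_change C P' \<phi> Q) =
        base_change C P' \<phi> (closure_in elts C I P Q))"

end

theory Submission
  imports Defs
begin

text \<open>
  Everything is governed by one construction. For a sub-presheaf \<open>Q\<close> of \<open>P\<close> and a section
  \<open>p \<in> P(X)\<close>, the sieve \<open>char_sieve P Q X p\<close> consists of the \<open>x : Y \<rightarrow> X\<close> with \<open>P(x)(p) \<in> Q(Y)\<close>;
  it is the inverse image of \<open>Q\<close> under the morphism \<open>y(X) \<rightarrow> P\<close> that corresponds to \<open>p\<close>. It is the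
  maximal sieve exactly when \<open>p \<in> Q(X)\<close>, the pullback of a sieve along \<open>x\<close> is a special case of
  it, and it is compatible with pullback along \<open>x\<close> (\<open>sieve_pullback_char_sieve\<close>) and with base
  change along \<open>P' \<rightarrow> P\<close> (\<open>char_sieve_base_change\<close>).

  Topologies. Every \<open>G(I)\<close> is a topology: the axioms are read off the relation, because it
  quantifies over all \<open>x : X' \<rightarrow> X\<close>. Conversely let \<open>J\<close> be a topology. The sections \<open>p\<close> with
  \<open>char_sieve P Q X p \<in> J\<close> form a sub-presheaf \<open>local_closure J P Q\<close> of \<open>P\<close>, and transitivity of \<open>J\<close>
  says precisely that it lies in \<open>F(J)\<close>. If \<open>D\<close> is a sieve on \<open>X\<close> in \<open>G(F(J))\<close>, test it against the
  closure of \<open>D\<close> itself in \<open>y(X)\<close>: every element of \<open>D\<close> sends \<open>id\<close> into this closure, so the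
  closure contains \<open>id\<close>, and this means \<open>D \<in> J\<close>.

  Closure properties. For a topology \<open>J\<close>, \<open>local_closure J P Q\<close> is the smallest element of \<open>F(J)\<close>
  above \<open>Q\<close>, and compatibility of \<open>char_sieve\<close> with base change gives condition (4) for \<open>F(J)\<close>.
  Conversely let \<open>I\<close> be a closure property, let \<open>(Q, P) \<in> F(G(I))\<close>, and let \<open>R\<close> be the \<open>I\<close>-closure of
  \<open>Q\<close> in \<open>P\<close>. For \<open>p \<in> R(X)\<close>, condition (4) shows that \<open>char_sieve P Q X p\<close> and all its pullbacks are
  dense, that is, have the maximal sieve as \<open>I\<close>-closure. A sieve with this property belongs to
  \<open>G(I)\<close>: if a pullback of it sends a section \<open>p'\<close> of \<open>P'\<close> into \<open>Q'\<close>, for \<open>(Q', P') \<in> I\<close>, then it lies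
  below the element \<open>char_sieve P' Q' Y p'\<close> of \<open>I\<close>, which is therefore maximal. So \<open>(Q, P)\<close> is
  orthogonal to the sieve of \<open>p\<close>, which puts \<open>p\<close> in \<open>Q(X)\<close>, and \<open>Q = R\<close> is in \<open>I\<close>.

  Essential smallness serves two purposes: representable presheaves have small values, and the
  closure of \<open>Q\<close>, which is the intersection of a possibly large class of sub-presheaves, can be
  written with intersections of small families (\<open>smallest_above_closure_in\<close>).
\<close>

section \<open>Presheaves and sub-presheaves\<close>

text \<open>
  The two consequences of essential smallness on which the argument rests. The objects \<open>F k\<close>, for
  \<open>k\<close> in a set, represent all objects up to retracts; this is enough for a sub-presheaf to be
  determined by its values at them.
\<close>

locale presheaf_universe = universe elts + category C
  for elts :: "'v \<Rightarrow> 'v set" and C :: "('o, 'v) category_data" +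
  assumes small_homset: "X \<in> Ob C \<Longrightarrow> Y \<in> Ob C \<Longrightarrow> small elts (homset C X Y)"
    and small_retracts: "\<exists>K F. \<forall>X\<in>Ob C. \<exists>k\<in>elts K. \<exists>s\<in>homset C X (F k). \<exists>r\<in>homset C (F k) X.
      cmp C r s = ident C X"
begin

lemma small_subset: "small elts B \<Longrightarrow> A \<subseteq> B \<Longrightarrow> small elts A"
  unfolding small_def using separation by blast

lemma homset_Ob: "f \<in> homset C X Y \<Longrightarrow> X \<in> Ob C \<and> Y \<in> Ob C"
  using src_in tgt_in by (auto simp: homset_def)

lemma homset_Ar: "f \<in> homset C X Y \<Longrightarrow> f \<in> Ar C \<and> src C f = X \<and> tgt C f = Y"
  by (auto simp: homset_def)

lemma Ar_homset: "f \<in> Ar C \<Longrightarrow> f \<in> homset C (src C f) (tgt C f)"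
  by (auto simp: homset_def)

lemma presheaf_sec: "presheaf elts C P \<Longrightarrow> sec P \<in> Ob C \<rightarrow>\<^sub>E {A. small elts A}"
  unfolding presheaf_def by (elim conjE)

lemma presheaf_act:
  "presheaf elts C P \<Longrightarrow> act P \<in> (\<Pi>\<^sub>E f\<in>Ar C. sec P (tgt C f) \<rightarrow>\<^sub>E sec P (src C f))"
  unfolding presheaf_def by (elim conjE)

lemma act_in:
  assumes "presheaf elts C P" "f \<in> homset C Y X" "p \<in> sec P X"
  shows "act P f p \<in> sec P Y"
  using assms unfolding presheaf_def homset_def by (auto simp: PiE_iff)

lemma act_ident: "presheaf elts C P \<Longrightarrow> X \<in> Ob C \<Longrightarrow> p \<in> sec P X \<Longrightarrow> act P (ident C X) p = p"
  unfolding presheaf_def by blast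

lemma act_cmp:
  assumes "presheaf elts C P" "f \<in> homset C Z Y" "g \<in> homset C Y X" "p \<in> sec P X"
  shows "act P (cmp C g f) p = act P f (act P g p)"
  using assms unfolding presheaf_def homset_def by auto

lemma embedding_presheaf: "embedding elts C Q P \<Longrightarrow> presheaf elts C Q \<and> presheaf elts C P"
  unfolding embedding_def by blast

lemma embedding_sec: "embedding elts C Q P \<Longrightarrow> X \<in> Ob C \<Longrightarrow> q \<in> sec Q X \<Longrightarrow> q \<in> sec P X"
  unfolding embedding_def by blast

lemma embedding_act:
  assumes "embedding elts C Q P" "f \<in> homset C Y X" "q \<in> sec Q X"
  shows "act P f q \<in> sec Q Y"
  using assms act_in[of Q f Y X q] unfolding embedding_def homset_def by auto

lemma embedding_refl: "presheaf elts C P \<Longrightarrow> embedding elts C P P"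
  unfolding embedding_def by blast

lemma embedding_iff_sec_subset:
  assumes "embedding elts C Q P" "embedding elts C R P"
  shows "embedding elts C Q R \<longleftrightarrow> (\<forall>X\<in>Ob C. sec Q X \<subseteq> sec R X)"
proof
  assume *: "\<forall>X\<in>Ob C. sec Q X \<subseteq> sec R X"
  have "act Q f q = act R f q" if "f \<in> Ar C" "q \<in> sec Q (tgt C f)" for f q
  proof -
    have "q \<in> sec R (tgt C f)" using * that tgt_in by blast
    then show ?thesis using assms that unfolding embedding_def by simp
  qed
  with * assms show "embedding elts C Q R" unfolding embedding_def by blast
qed (auto simp: embedding_def)

text \<open>
  Functions being extensional, a sub-presheaf is determined as a record by its values at objects:
  its action is restricted from that of \<open>P\<close>.
\<close>

lemma subpresheaf_eqI:
  assumes Q: "embedding elts C Q P" and R: "embedding elts C R P"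
    and eq: "\<And>X. X \<in> Ob C \<Longrightarrow> sec Q X = sec R X"
  shows "Q = R"
proof -
  have presheaves: "presheaf elts C Q" "presheaf elts C R"
    using Q R embedding_presheaf by blast+
  have sec: "sec Q = sec R"
    by (rule PiE_ext[OF presheaf_sec presheaf_sec]) (rule presheaves eq, assumption?)+
  have "act Q f p = act R f p" for f p
  proof (cases "f \<in> Ar C")
    case False
    then show ?thesis
      using PiE_arb[OF presheaf_act[OF presheaves(1)]] PiE_arb[OF presheaf_act[OF presheaves(2)]]
      by simp
  next
    case True
    have ext: "act Q f \<in> sec Q (tgt C f) \<rightarrow>\<^sub>E sec Q (src C f)"
      "act R f \<in> sec R (tgt C f) \<rightarrow>\<^sub>E sec R (src C f)"
      using presheaves[THEN presheaf_act] True by (auto dest: PiE_mem)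
    show ?thesis
    proof (cases "p \<in> sec Q (tgt C f)")
      case True
      then show ?thesis using Q R \<open>f \<in> Ar C\<close> sec by (simp add: embedding_def)
    next
      case False
      then show ?thesis using PiE_arb[OF ext(1)] PiE_arb[OF ext(2)] sec by simp
    qed
  qed
  then have "act Q = act R" by (intro ext)
  with sec show ?thesis by simp
qed

lemma embedding_antisym:
  "embedding elts C Q R \<Longrightarrow> embedding elts C R Q \<Longrightarrow> Q = R"
  by (rule subpresheaf_eqI[of Q R R])
    (auto simp: embedding_def)

lemma sec_subpresheaf_on: "X \<in> Ob C \<Longrightarrow> sec (subpresheaf_on C P A) X = A X"
  by (simp add: subpresheaf_on_def)

lemma embedding_subpresheaf_on:
  assumes P: "presheaf elts C P"
    and sub: "\<And>X. X \<in> Ob C \<Longrightarrow> A X \<subseteq> sec P X"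
    and stable: "\<And>X Y f p. f \<in> homset C Y X \<Longrightarrow> p \<in> A X \<Longrightarrow> act P f p \<in> A Y"
  shows "embedding elts C (subpresheaf_on C P A) P"
proof -
  let ?Q = "subpresheaf_on C P A"
  have sec: "sec ?Q X = A X" if "X \<in> Ob C" for X
    using that by (rule sec_subpresheaf_on)
  have act: "act ?Q f p = act P f p" if "f \<in> Ar C" "p \<in> A (tgt C f)" for f p
    using that by (simp add: subpresheaf_on_def)
  have "small elts (A X)" if "X \<in> Ob C" for X
    using small_subset[OF _ sub[OF that]] PiE_mem[OF presheaf_sec[OF P] that] by simp
  then have "sec ?Q \<in> Ob C \<rightarrow>\<^sub>E {A. small elts A}"
    unfolding subpresheaf_on_def by auto
  moreover have "act ?Q \<in> (\<Pi>\<^sub>E f\<in>Ar C. sec ?Q (tgt C f) \<rightarrow>\<^sub>E sec ?Q (src C f))"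
  proof (rule PiE_I)
    fix f assume f: "f \<in> Ar C"
    show "act ?Q f \<in> sec ?Q (tgt C f) \<rightarrow>\<^sub>E sec ?Q (src C f)"
      using f stable[OF Ar_homset[OF f]]
      by (auto simp: sec src_in tgt_in act) (simp add: subpresheaf_on_def)
  qed (simp add: subpresheaf_on_def)
  moreover have "act ?Q (ident C X) p = p" if "X \<in> Ob C" "p \<in> sec ?Q X" for X p
  proof -
    have "p \<in> A X" "p \<in> sec P X" "ident C X \<in> Ar C" "tgt C (ident C X) = X"
      using that sec sub ident_in[of X] by (auto simp: homset_def)
    then show ?thesis using act act_ident[OF P] that by simp
  qed
  moreover have "act ?Q (cmp C g f) p = act ?Q f (act ?Q g p)"
    if "f \<in> Ar C" "g \<in> Ar C" "src C g = tgt C f" "p \<in> sec ?Q (tgt C g)" for f g p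
  proof -
    have p: "p \<in> A (tgt C g)" using that sec tgt_in by blast
    then have p': "p \<in> sec P (tgt C g)" using sub that tgt_in by blast
    have f: "f \<in> homset C (src C f) (tgt C f)" and g: "g \<in> homset C (tgt C f) (tgt C g)"
      using that by (auto simp: homset_def)
    have "act P g p \<in> A (tgt C f)" using stable[OF g p] .
    moreover have "cmp C g f \<in> Ar C" "tgt C (cmp C g f) = tgt C g"
      using homset_Ar[OF cmp_in[OF f g]] by auto
    ultimately show ?thesis using act_cmp[OF P f g p'] that p by (simp add: act)
  qed
  ultimately have "presheaf elts C ?Q" unfolding presheaf_def by blast
  then show ?thesis using P sub sec act tgt_in unfolding embedding_def by auto
qed

lemma morphism_in:
  "presheaf_morphism C P' P \<phi> \<Longrightarrow> X \<in> Ob C \<Longrightarrow> p \<in> sec P' X \<Longrightarrow> \<phi> X p \<in> sec P X"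
  unfolding presheaf_morphism_def by (auto simp: PiE_iff)

lemma morphism_act:
  "presheaf_morphism C P' P \<phi> \<Longrightarrow> f \<in> homset C Y X \<Longrightarrow> p \<in> sec P' X \<Longrightarrow>
   \<phi> Y (act P' f p) = act P f (\<phi> X p)"
  unfolding presheaf_morphism_def homset_def by blast

lemma sec_base_change:
  "X \<in> Ob C \<Longrightarrow> sec (base_change C P' \<phi> Q) X = {p \<in> sec P' X. \<phi> X p \<in> sec Q X}"
  unfolding base_change_def by (rule sec_subpresheaf_on)

lemma embedding_base_change:
  assumes "presheaf elts C P'" "presheaf_morphism C P' P \<phi>" "embedding elts C Q P"
  shows "embedding elts C (base_change C P' \<phi> Q) P'"
  unfolding base_change_def using assms
  by (intro embedding_subpresheaf_on) (auto simp: act_in morphism_act embedding_act)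

lemma sec_intersection:
  "X \<in> Ob C \<Longrightarrow> sec (intersection C P K Q) X = {p \<in> sec P X. \<forall>k\<in>K. p \<in> sec (Q k) X}"
  unfolding intersection_def by (rule sec_subpresheaf_on)

lemma embedding_intersection:
  assumes "presheaf elts C P" "\<And>k. k \<in> K \<Longrightarrow> embedding elts C (Q k) P"
  shows "embedding elts C (intersection C P K Q) P"
  unfolding intersection_def using assms
  by (intro embedding_subpresheaf_on) (auto simp: act_in embedding_act)


section \<open>Representable presheaves and sieves\<close>

lemma sec_yoneda: "Y \<in> Ob C \<Longrightarrow> sec (yoneda C X) Y = homset C Y X"
  by (simp add: yoneda_def)

lemma act_yoneda:
  "f \<in> homset C Z Y \<Longrightarrow> g \<in> homset C Y X \<Longrightarrow> act (yoneda C X) f g = cmp C g f"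
  by (auto simp: yoneda_def homset_def)

lemma presheaf_yoneda:
  assumes X: "X \<in> Ob C"
  shows "presheaf elts C (yoneda C X)"
proof -
  let ?y = "yoneda C X"
  have "sec ?y \<in> Ob C \<rightarrow>\<^sub>E {A. small elts A}"
    using X small_homset by (auto simp: yoneda_def)
  moreover have "act ?y \<in> (\<Pi>\<^sub>E f\<in>Ar C. sec ?y (tgt C f) \<rightarrow>\<^sub>E sec ?y (src C f))"
  proof (rule PiE_I)
    fix f assume f: "f \<in> Ar C"
    show "act ?y f \<in> sec ?y (tgt C f) \<rightarrow>\<^sub>E sec ?y (src C f)"
      using f cmp_in[OF Ar_homset[OF f]]
      by (auto simp: sec_yoneda src_in tgt_in act_yoneda[OF Ar_homset[OF f]])
        (simp add: yoneda_def)
  qed (simp add: yoneda_def)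
  moreover have "act ?y (ident C Y) p = p" if "Y \<in> Ob C" "p \<in> sec ?y Y" for Y p
    using that by (simp add: sec_yoneda act_yoneda[OF ident_in] cmp_ident_right)
  moreover have "act ?y (cmp C g f) p = act ?y f (act ?y g p)"
    if "f \<in> Ar C" "g \<in> Ar C" "src C g = tgt C f" "p \<in> sec ?y (tgt C g)" for f g p
  proof -
    have f: "f \<in> homset C (src C f) (tgt C f)" and g: "g \<in> homset C (tgt C f) (tgt C g)"
      and p: "p \<in> homset C (tgt C g) X"
      using that by (auto simp: homset_def sec_yoneda tgt_in)
    show ?thesis
      using cmp_assoc[OF f g p] cmp_in[OF g p]
      by (simp add: act_yoneda[OF cmp_in[OF f g] p] act_yoneda[OF g p] act_yoneda[OF f])
  qed
  ultimately show ?thesis unfolding presheaf_def by blast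
qed

text \<open>
  The morphism \<open>y(X) \<rightarrow> P\<close> that corresponds to \<open>p \<in> P(X)\<close> by the Yoneda lemma. For \<open>P\<close> itself
  representable it specialises to \<open>yoneda_map\<close>.
\<close>

definition section_map :: "('o, 'v) presheaf_data \<Rightarrow> 'o \<Rightarrow> 'v \<Rightarrow> 'o \<Rightarrow> 'v \<Rightarrow> 'v" where
  "section_map P X p = (\<lambda>Y\<in>Ob C. \<lambda>x\<in>homset C Y X. act P x p)"

lemma section_map_apply: "x \<in> homset C Y X \<Longrightarrow> section_map P X p Y x = act P x p"
  using homset_Ob by (simp add: section_map_def)

lemma presheaf_morphism_section_map:
  assumes P: "presheaf elts C P" and p: "p \<in> sec P X"
  shows "presheaf_morphism C (yoneda C X) P (section_map P X p)"
  unfolding presheaf_morphism_def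
proof (intro conjI ballI)
  show "section_map P X p \<in> (\<Pi>\<^sub>E Y\<in>Ob C. sec (yoneda C X) Y \<rightarrow>\<^sub>E sec P Y)"
    using act_in[OF P _ p] by (auto simp: section_map_def sec_yoneda)
  fix f x assume f: "f \<in> Ar C" and "x \<in> sec (yoneda C X) (tgt C f)"
  then have x: "x \<in> homset C (tgt C f) X" by (simp add: sec_yoneda tgt_in)
  show "section_map P X p (src C f) (act (yoneda C X) f x) =
      act P f (section_map P X p (tgt C f) x)"
    using act_cmp[OF P Ar_homset[OF f] x p] cmp_in[OF Ar_homset[OF f] x]
    by (simp add: act_yoneda[OF Ar_homset[OF f] x] section_map_apply x)
qed

lemma yoneda_map_eq_section_map:
  assumes x: "x \<in> homset C X' X"
  shows "yoneda_map C x = section_map (yoneda C X) X' x"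
proof -
  have "src C x = X'" using x by (simp add: homset_def)
  then show ?thesis
    using act_yoneda[OF _ x] by (auto simp: yoneda_map_def section_map_def fun_eq_iff restrict_def)
qed

text \<open>
  The value at \<open>p\<close> of the characteristic morphism of \<open>Q\<close>, from \<open>P\<close> to the presheaf of sieves.
  The form as a base change makes the axioms of a closure property directly applicable to it.
\<close>

definition char_sieve ::
  "('o, 'v) presheaf_data \<Rightarrow> ('o, 'v) presheaf_data \<Rightarrow> 'o \<Rightarrow> 'v \<Rightarrow> ('o, 'v) presheaf_data" where
  "char_sieve P Q X p = base_change C (yoneda C X) (section_map P X p) Q"

lemma sec_char_sieve:
  "Y \<in> Ob C \<Longrightarrow> sec (char_sieve P Q X p) Y = {x \<in> homset C Y X. act P x p \<in> sec Q Y}"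
  by (auto simp: char_sieve_def sec_base_change sec_yoneda section_map_apply)

lemma embedding_char_sieve:
  assumes "embedding elts C Q P" "X \<in> Ob C" "p \<in> sec P X"
  shows "embedding elts C (char_sieve P Q X p) (yoneda C X)"
proof -
  have "presheaf elts C P" using embedding_presheaf[OF assms(1)] by blast
  then show ?thesis
    unfolding char_sieve_def
    using embedding_base_change[OF presheaf_yoneda presheaf_morphism_section_map] assms by blast
qed

lemma sieve_pullback_eq_char_sieve:
  assumes x: "x \<in> homset C X' X"
  shows "sieve_pullback C x D = char_sieve (yoneda C X) D X' x"
  using x homset_Ar[OF x] by (simp add: sieve_pullback_def char_sieve_def yoneda_map_eq_section_map)

lemma sec_sieve_pullback:
  assumes "x \<in> homset C X' X" "Y \<in> Ob C"
  shows "sec (sieve_pullback C x D) Y = {x' \<in> homset C Y X'. cmp C x x' \<in> sec D Y}"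
  using assms by (auto simp: sieve_pullback_eq_char_sieve sec_char_sieve act_yoneda)

lemma embedding_sieve_pullback:
  assumes "x \<in> homset C X' X" "embedding elts C D (yoneda C X)"
  shows "embedding elts C (sieve_pullback C x D) (yoneda C X')"
  using assms homset_Ob[OF assms(1)]
  by (auto simp: sieve_pullback_eq_char_sieve sec_yoneda intro!: embedding_char_sieve)

text \<open>
  Naturality of the characteristic morphism: \<open>x'\<close> followed by \<open>x\<close> acts on \<open>p\<close> as \<open>x'\<close> does on
  \<open>P(x)(p)\<close>.
\<close>

lemma sieve_pullback_char_sieve:
  assumes "embedding elts C Q P" "x \<in> homset C X' X" "p \<in> sec P X"
  shows "sieve_pullback C x (char_sieve P Q X p) = char_sieve P Q X' (act P x p)"
proof (rule subpresheaf_eqI)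
  have P: "presheaf elts C P" and Ob: "X \<in> Ob C" "X' \<in> Ob C"
    using assms embedding_presheaf homset_Ob by blast+
  show "embedding elts C (sieve_pullback C x (char_sieve P Q X p)) (yoneda C X')"
    by (rule embedding_sieve_pullback[OF assms(2) embedding_char_sieve[OF assms(1) Ob(1) assms(3)]])
  show "embedding elts C (char_sieve P Q X' (act P x p)) (yoneda C X')"
    using assms Ob act_in[OF P] by (intro embedding_char_sieve)
  show "sec (sieve_pullback C x (char_sieve P Q X p)) Y = sec (char_sieve P Q X' (act P x p)) Y"
    if "Y \<in> Ob C" for Y
    using that assms cmp_in[OF _ assms(2)]
    by (auto simp: sec_sieve_pullback sec_char_sieve act_cmp[OF P _ assms(2,3)])
qed

lemma sieve_pullback_ident:
  assumes "X \<in> Ob C" "embedding elts C D (yoneda C X)"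
  shows "sieve_pullback C (ident C X) D = D"
proof (rule subpresheaf_eqI)
  show "embedding elts C (sieve_pullback C (ident C X) D) (yoneda C X)"
    using assms ident_in by (intro embedding_sieve_pullback)
  show "sec (sieve_pullback C (ident C X) D) Y = sec D Y" if "Y \<in> Ob C" for Y
  proof -
    have "sec D Y \<subseteq> homset C Y X" using embedding_sec[OF assms(2) that] that by (auto simp: sec_yoneda)
    then show ?thesis
      using that by (auto simp: sec_sieve_pullback[OF ident_in[OF assms(1)]] cmp_ident_left)
  qed
qed fact

text \<open>
  A sieve is maximal as soon as it contains the identity.
\<close>

lemma char_sieve_member:
  assumes Q: "embedding elts C Q P" and X: "X \<in> Ob C" and p: "p \<in> sec P X"
  shows "char_sieve P Q X p = yoneda C X \<longleftrightarrow> p \<in> sec Q X"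
proof
  assume "char_sieve P Q X p = yoneda C X"
  then have "ident C X \<in> sec (char_sieve P Q X p) X"
    using X ident_in by (simp add: sec_yoneda)
  then show "p \<in> sec Q X"
    using X p act_ident embedding_presheaf[OF Q] by (simp add: sec_char_sieve)
next
  assume q: "p \<in> sec Q X"
  show "char_sieve P Q X p = yoneda C X"
    using embedding_act[OF Q _ q]
    by (intro subpresheaf_eqI[OF embedding_char_sieve[OF Q X p] embedding_refl[OF presheaf_yoneda[OF X]]])
      (auto simp: sec_char_sieve sec_yoneda)
qed

lemma char_sieve_base_change:
  assumes P': "presheaf elts C P'" and \<phi>: "presheaf_morphism C P' P \<phi>"
    and Q: "embedding elts C Q P" and X: "X \<in> Ob C" and p: "p \<in> sec P' X"
  shows "char_sieve P' (base_change C P' \<phi> Q) X p = char_sieve P Q X (\<phi> X p)"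
proof (rule subpresheaf_eqI)
  show "embedding elts C (char_sieve P' (base_change C P' \<phi> Q) X p) (yoneda C X)"
    using assms by (intro embedding_char_sieve embedding_base_change)
  show "embedding elts C (char_sieve P Q X (\<phi> X p)) (yoneda C X)"
    using assms morphism_in by (intro embedding_char_sieve)
  show "sec (char_sieve P' (base_change C P' \<phi> Q) X p) Y = sec (char_sieve P Q X (\<phi> X p)) Y"
    if "Y \<in> Ob C" for Y
    using that p by (auto simp: sec_char_sieve sec_base_change morphism_act[OF \<phi>] act_in[OF P'])
qed


section \<open>Duality and topologies\<close>

lemma sieves_iff: "(X, D) \<in> sieves elts C \<longleftrightarrow> X \<in> Ob C \<and> embedding elts C D (yoneda C X)"
  by (simp add: sieves_def)

lemma subpresheaves_iff: "(Q, P) \<in> subpresheaves elts C \<longleftrightarrow> embedding elts C Q P"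
  by (simp add: subpresheaves_def)

lemma duality_iff:
  assumes "(X, D) \<in> sieves elts C" "(Q, P) \<in> subpresheaves elts C"
  shows "((X, D), (Q, P)) \<in> duality elts C \<longleftrightarrow>
    (\<forall>X' x p. x \<in> homset C X' X \<and> p \<in> sec P X' \<and>
       (\<forall>X'' x'. x' \<in> homset C X'' X' \<and> cmp C x x' \<in> sec D X'' \<longrightarrow> act P x' p \<in> sec Q X'') \<longrightarrow>
       p \<in> sec Q X')"
proof -
  have "(\<forall>X''\<in>Ob C. \<forall>x'\<in>sec (sieve_pullback C x D) X''. act P x' p \<in> sec Q X'') \<longleftrightarrow>
    (\<forall>X'' x'. x' \<in> homset C X'' X' \<and> cmp C x x' \<in> sec D X'' \<longrightarrow> act P x' p \<in> sec Q X'')"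
    if "x \<in> homset C X' X" for X' x p
    using homset_Ob by (auto simp: sec_sieve_pullback[OF that])
  with assms show ?thesis unfolding duality_def using homset_Ob by simp blast
qed

lemma dualityD:
  assumes "((X, D), (Q, P)) \<in> duality elts C" "x \<in> homset C X' X" "p \<in> sec P X'"
    and "\<And>X'' x'. x' \<in> homset C X'' X' \<Longrightarrow> cmp C x x' \<in> sec D X'' \<Longrightarrow> act P x' p \<in> sec Q X''"
  shows "p \<in> sec Q X'"
proof -
  have "(X, D) \<in> sieves elts C" "(Q, P) \<in> subpresheaves elts C"
    using assms(1) by (auto simp: duality_def)
  then show ?thesis using duality_iff assms by blast
qed

lemma topologyD:
  assumes "grothendieck_topology elts C J"
  shows "J \<subseteq> sieves elts C"
    and "X \<in> Ob C \<Longrightarrow> (X, yoneda C X) \<in> J"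
    and "(X, D) \<in> J \<Longrightarrow> x \<in> homset C X' X \<Longrightarrow> (X', sieve_pullback C x D) \<in> J"
    and "(X, D) \<in> J \<Longrightarrow> (X, D') \<in> sieves elts C \<Longrightarrow>
      (\<And>X' x. X' \<in> Ob C \<Longrightarrow> x \<in> sec D X' \<Longrightarrow> (X', sieve_pullback C x D') \<in> J) \<Longrightarrow> (X, D') \<in> J"
  using assms unfolding grothendieck_topology_def by blast+

text \<open>
  Maximality: an element of \<open>P\<close> that the identity sends into \<open>Q\<close> is in \<open>Q\<close>. Pullbacks: the
  condition for the pullback along \<open>x\<close>, at \<open>y\<close>, is the one for \<open>D\<close> at the composite. Transitivity:
  by the condition for \<open>D\<close> it suffices to bring \<open>P(y)(p)\<close> into \<open>Q\<close> for all \<open>y\<close> whose composite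
  with \<open>x\<close> is in \<open>D\<close>, and for this the condition for the pullback of \<open>D'\<close> along that composite is
  used at the identity.
\<close>

lemma grothendieck_topology_G_dual:
  assumes I: "I \<subseteq> subpresheaves elts C"
  shows "grothendieck_topology elts C (G_dual elts C I)"
proof -
  have G: "(X, D) \<in> G_dual elts C I \<longleftrightarrow> (X, D) \<in> sieves elts C \<and>
      (\<forall>Q P. (Q, P) \<in> I \<longrightarrow> ((X, D), (Q, P)) \<in> duality elts C)" for X D
    unfolding G_dual_def by auto
  have maximal: "(X, yoneda C X) \<in> G_dual elts C I" if X: "X \<in> Ob C" for X
  proof -
    have s: "(X, yoneda C X) \<in> sieves elts C"
      using X by (simp add: sieves_iff embedding_refl presheaf_yoneda)
    have "((X, yoneda C X), (Q, P)) \<in> duality elts C" if QP: "(Q, P) \<in> I" for Q P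
    proof -
      have QP: "(Q, P) \<in> subpresheaves elts C" using I QP by blast
      then have P: "presheaf elts C P" using subpresheaves_iff embedding_presheaf by blast
      show ?thesis unfolding duality_iff[OF s QP]
      proof (intro allI impI, elim conjE)
        fix X' x p
        assume x: "x \<in> homset C X' X" and p: "p \<in> sec P X'"
          and *: "\<forall>X'' x'. x' \<in> homset C X'' X' \<and> cmp C x x' \<in> sec (yoneda C X) X'' \<longrightarrow>
            act P x' p \<in> sec Q X''"
        have X': "X' \<in> Ob C" using homset_Ob[OF x] by blast
        show "p \<in> sec Q X'"
          using *[rule_format, OF conjI[OF ident_in[OF X']]] x X' p
          by (simp add: cmp_ident_right sec_yoneda act_ident[OF P])
      qed
    qed
    with s show ?thesis unfolding G by blast
  qed
  have pullback: "(X', sieve_pullback C x D) \<in> G_dual elts C I"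
    if D: "(X, D) \<in> G_dual elts C I" and x: "x \<in> homset C X' X" for X D X' x
  proof -
    have emb: "embedding elts C D (yoneda C X)" using D unfolding G sieves_iff by blast
    have s: "(X', sieve_pullback C x D) \<in> sieves elts C"
      using emb x homset_Ob[OF x] by (simp add: sieves_iff embedding_sieve_pullback)
    have "((X', sieve_pullback C x D), (Q, P)) \<in> duality elts C" if QP: "(Q, P) \<in> I" for Q P
    proof -
      have dual: "((X, D), (Q, P)) \<in> duality elts C" using D QP unfolding G by blast
      have QP: "(Q, P) \<in> subpresheaves elts C" using I QP by blast
      show ?thesis unfolding duality_iff[OF s QP]
      proof (intro allI impI, elim conjE)
        fix X'' y p
        assume y: "y \<in> homset C X'' X'" and p: "p \<in> sec P X''"
          and *: "\<forall>Z z. z \<in> homset C Z X'' \<and> cmp C y z \<in> sec (sieve_pullback C x D) Z \<longrightarrow>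
            act P z p \<in> sec Q Z"
        show "p \<in> sec Q X''"
        proof (rule dualityD[OF dual cmp_in[OF y x] p])
          fix Z z assume z: "z \<in> homset C Z X''" and "cmp C (cmp C x y) z \<in> sec D Z"
          then have "cmp C y z \<in> sec (sieve_pullback C x D) Z"
            using homset_Ob[OF z] cmp_in[OF z y] cmp_assoc[OF z y x]
            by (simp add: sec_sieve_pullback[OF x])
          then show "act P z p \<in> sec Q Z" using * z by blast
        qed
      qed
    qed
    with s show ?thesis unfolding G by blast
  qed
  have transitive: "(X, D') \<in> G_dual elts C I"
    if D: "(X, D) \<in> G_dual elts C I" and s: "(X, D') \<in> sieves elts C"
      and cover: "\<forall>X'\<in>Ob C. \<forall>x\<in>sec D X'. (X', sieve_pullback C x D') \<in> G_dual elts C I"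
    for X D D'
  proof -
    have emb: "embedding elts C D (yoneda C X)" using D unfolding G sieves_iff by blast
    have "((X, D'), (Q, P)) \<in> duality elts C" if QP: "(Q, P) \<in> I" for Q P
    proof -
      have dual: "((X, D), (Q, P)) \<in> duality elts C" using D QP unfolding G by blast
      have QPs: "(Q, P) \<in> subpresheaves elts C" using I QP by blast
      then have P: "presheaf elts C P" using subpresheaves_iff embedding_presheaf by blast
      show ?thesis unfolding duality_iff[OF s QPs]
      proof (intro allI impI, elim conjE)
        fix X' x p
        assume x: "x \<in> homset C X' X" and p: "p \<in> sec P X'"
          and *: "\<forall>Z z. z \<in> homset C Z X' \<and> cmp C x z \<in> sec D' Z \<longrightarrow> act P z p \<in> sec Q Z"
        show "p \<in> sec Q X'"
        proof (rule dualityD[OF dual x p])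
          fix Y y assume y: "y \<in> homset C Y X'" and xy: "cmp C x y \<in> sec D Y"
          have Y: "Y \<in> Ob C" using homset_Ob[OF y] by blast
          have h: "cmp C x y \<in> homset C Y X" using cmp_in[OF y x] .
          have dual': "((Y, sieve_pullback C (cmp C x y) D'), (Q, P)) \<in> duality elts C"
            using cover Y xy QP unfolding G by blast
          show "act P y p \<in> sec Q Y"
          proof (rule dualityD[OF dual' ident_in[OF Y] act_in[OF P y p]])
            fix Z z assume z: "z \<in> homset C Z Y"
              and "cmp C (ident C Y) z \<in> sec (sieve_pullback C (cmp C x y) D') Z"
            then have "cmp C x (cmp C y z) \<in> sec D' Z"
              using homset_Ob[OF z] cmp_assoc[OF z y x]
              by (simp add: cmp_ident_left sec_sieve_pullback[OF h])
            then show "act P z (act P y p) \<in> sec Q Z"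
              using * cmp_in[OF z y] act_cmp[OF P z y p] by metis
          qed
        qed
      qed
    qed
    with s show ?thesis unfolding G by blast
  qed
  show ?thesis
    unfolding grothendieck_topology_def
    using maximal pullback transitive by (auto simp: G_dual_def)
qed

text \<open>
  The sections of \<open>P\<close> that belong to \<open>Q\<close> locally for \<open>J\<close>.
\<close>

definition local_closure ::
  "('o, 'v) sieve set \<Rightarrow> ('o, 'v) presheaf_data \<Rightarrow> ('o, 'v) presheaf_data \<Rightarrow>
   ('o, 'v) presheaf_data" where
  "local_closure J P Q = subpresheaf_on C P (\<lambda>X. {p \<in> sec P X. (X, char_sieve P Q X p) \<in> J})"

lemma sec_local_closure:
  "X \<in> Ob C \<Longrightarrow> sec (local_closure J P Q) X = {p \<in> sec P X. (X, char_sieve P Q X p) \<in> J}"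
  unfolding local_closure_def by (rule sec_subpresheaf_on)

lemma embedding_local_closure:
  assumes J: "grothendieck_topology elts C J" and Q: "embedding elts C Q P"
  shows "embedding elts C (local_closure J P Q) P"
  unfolding local_closure_def
proof (rule embedding_subpresheaf_on)
  show P: "presheaf elts C P" using embedding_presheaf[OF Q] by blast
  show "act P f p \<in> {p \<in> sec P Y. (Y, char_sieve P Q Y p) \<in> J}"
    if f: "f \<in> homset C Y X" and p: "p \<in> {p \<in> sec P X. (X, char_sieve P Q X p) \<in> J}" for X Y f p
    using p f act_in[OF P f] topologyD(3)[OF J _ f] sieve_pullback_char_sieve[OF Q f] by force
qed blast

text \<open>
  This is the transitivity axiom. If the pullback of a covering sieve \<open>D\<close> sends \<open>p\<close> into the
  closure, then the characteristic sieve of \<open>p\<close> becomes covering after pullback along each element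
  of a covering sieve, and so is covering itself.
\<close>

lemma local_closure_in_F_dual:
  assumes J: "grothendieck_topology elts C J" and Q: "embedding elts C Q P"
  shows "(local_closure J P Q, P) \<in> F_dual elts C J"
proof -
  have P: "presheaf elts C P" using embedding_presheaf[OF Q] by blast
  have s: "(local_closure J P Q, P) \<in> subpresheaves elts C"
    using embedding_local_closure[OF J Q] by (simp add: subpresheaves_iff)
  have "((X, D), (local_closure J P Q, P)) \<in> duality elts C" if D: "(X, D) \<in> J" for X D
  proof -
    have t: "(X, D) \<in> sieves elts C" using topologyD(1)[OF J] D by blast
    show ?thesis unfolding duality_iff[OF t s]
    proof (intro allI impI, elim conjE)
      fix X' x p
      assume x: "x \<in> homset C X' X" and p: "p \<in> sec P X'"
        and *: "\<forall>Y y. y \<in> homset C Y X' \<and> cmp C x y \<in> sec D Y \<longrightarrow>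
          act P y p \<in> sec (local_closure J P Q) Y"
      have X': "X' \<in> Ob C" using homset_Ob[OF x] by blast
      have "(X', char_sieve P Q X' p) \<in> J"
      proof (rule topologyD(4)[OF J topologyD(3)[OF J D x]])
        show "(X', char_sieve P Q X' p) \<in> sieves elts C"
          using embedding_char_sieve[OF Q X' p] X' by (simp add: sieves_iff)
        fix Y y assume Y: "Y \<in> Ob C" and "y \<in> sec (sieve_pullback C x D) Y"
        then have y: "y \<in> homset C Y X'" "cmp C x y \<in> sec D Y"
          by (auto simp: sec_sieve_pullback[OF x])
        then have "act P y p \<in> sec (local_closure J P Q) Y" using * by blast
        then show "(Y, sieve_pullback C y (char_sieve P Q X' p)) \<in> J"
          using Y by (simp add: sieve_pullback_char_sieve[OF Q y(1) p] sec_local_closure)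
      qed
      with p X' show "p \<in> sec (local_closure J P Q) X'" by (simp add: sec_local_closure)
    qed
  qed
  with s show ?thesis unfolding F_dual_def by auto
qed

lemma embedding_in_local_closure:
  assumes J: "grothendieck_topology elts C J" and Q: "embedding elts C Q P"
  shows "embedding elts C Q (local_closure J P Q)"
proof -
  have "sec Q X \<subseteq> sec (local_closure J P Q) X" if X: "X \<in> Ob C" for X
    using char_sieve_member[OF Q X] embedding_sec[OF Q X] topologyD(2)[OF J X]
    by (force simp: sec_local_closure[OF X])
  then show ?thesis
    using embedding_iff_sec_subset[OF Q embedding_local_closure[OF J Q]] by blast
qed

text \<open>
  For the nontrivial inclusion, \<open>D\<close> is tested against its own closure in \<open>y(X)\<close>, at the section
  \<open>id\<close>, whose characteristic sieve is \<open>D\<close>.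
\<close>

lemma G_dual_F_dual_topology:
  assumes J: "grothendieck_topology elts C J"
  shows "G_dual elts C (F_dual elts C J) = J"
proof
  show "J \<subseteq> G_dual elts C (F_dual elts C J)"
    using topologyD(1)[OF J] by (auto simp: G_dual_def F_dual_def)
  show "G_dual elts C (F_dual elts C J) \<subseteq> J"
  proof clarify
    fix X D assume XD: "(X, D) \<in> G_dual elts C (F_dual elts C J)"
    let ?R = "local_closure J (yoneda C X) D"
    have X: "X \<in> Ob C" and D: "embedding elts C D (yoneda C X)"
      using XD by (auto simp: G_dual_def sieves_iff)
    have dual: "((X, D), (?R, yoneda C X)) \<in> duality elts C"
      using XD local_closure_in_F_dual[OF J D] by (auto simp: G_dual_def)
    have "ident C X \<in> sec ?R X"
    proof (rule dualityD[OF dual ident_in[OF X]])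
      show "ident C X \<in> sec (yoneda C X) X" using X ident_in by (simp add: sec_yoneda)
      fix Y y assume y: "y \<in> homset C Y X" and "cmp C (ident C X) y \<in> sec D Y"
      then have "y \<in> sec D Y" by (simp add: cmp_ident_left)
      moreover have "Y \<in> Ob C" using homset_Ob[OF y] by blast
      ultimately have "y \<in> sec ?R Y"
        using embedding_sec[OF embedding_in_local_closure[OF J D]] by blast
      then show "act (yoneda C X) y (ident C X) \<in> sec ?R Y"
        by (simp add: act_yoneda[OF y ident_in[OF X]] cmp_ident_left[OF y])
    qed
    then show "(X, D) \<in> J"
      using sieve_pullback_ident[OF X D]
      by (simp add: sec_local_closure[OF X] sieve_pullback_eq_char_sieve[OF ident_in[OF X]])
  qed
qed


section \<open>Closure properties\<close>

lemma smallest_above_unique: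
  "smallest_above elts C I P Q R \<Longrightarrow> smallest_above elts C I P Q R' \<Longrightarrow> R = R'"
  unfolding smallest_above_def by (blast intro: embedding_antisym)

lemma closure_in_eq: "smallest_above elts C I P Q R \<Longrightarrow> closure_in elts C I P Q = R"
  unfolding closure_in_def using smallest_above_unique by blast

text \<open>
  If \<open>R\<close> contains \<open>Q\<close>, then the characteristic sieve of \<open>p\<close> sends \<open>p\<close> into \<open>R\<close>. When that sieve
  covers and \<open>R\<close> is dual to \<open>J\<close>, it follows that \<open>p\<close> is in \<open>R\<close>.
\<close>

lemma smallest_above_local_closure:
  assumes J: "grothendieck_topology elts C J" and Q: "embedding elts C Q P"
  shows "smallest_above elts C (F_dual elts C J) P Q (local_closure J P Q)"
proof -
  have "embedding elts C (local_closure J P Q) R"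
    if R: "(R, P) \<in> F_dual elts C J" and QR: "embedding elts C Q R" for R
  proof -
    have P: "presheaf elts C P" using embedding_presheaf[OF Q] by blast
    have RP: "embedding elts C R P" using R by (simp add: F_dual_def subpresheaves_iff)
    have "p \<in> sec R X" if X: "X \<in> Ob C" and "p \<in> sec (local_closure J P Q) X" for X p
    proof -
      have p: "p \<in> sec P X" and "(X, char_sieve P Q X p) \<in> J"
        using that by (auto simp: sec_local_closure)
      then have dual: "((X, char_sieve P Q X p), (R, P)) \<in> duality elts C"
        using R by (auto simp: F_dual_def)
      show ?thesis
      proof (rule dualityD[OF dual ident_in[OF X] p])
        fix Y y assume y: "y \<in> homset C Y X"
          and "cmp C (ident C X) y \<in> sec (char_sieve P Q X p) Y"
        then show "act P y p \<in> sec R Y"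
          using homset_Ob[OF y] embedding_sec[OF QR]
          by (simp add: cmp_ident_left sec_char_sieve)
      qed
    qed
    then show ?thesis
      using embedding_iff_sec_subset[OF embedding_local_closure[OF J Q] RP] by blast
  qed
  then show ?thesis unfolding smallest_above_def
    using local_closure_in_F_dual[OF J Q] embedding_in_local_closure[OF J Q] by blast
qed

lemma local_closure_base_change:
  assumes J: "grothendieck_topology elts C J" and P': "presheaf elts C P'"
    and \<phi>: "presheaf_morphism C P' P \<phi>" and Q: "embedding elts C Q P"
  shows "local_closure J P' (base_change C P' \<phi> Q) = base_change C P' \<phi> (local_closure J P Q)"
  by (rule subpresheaf_eqI[of _ P'])
    (auto intro!: embedding_local_closure embedding_base_change assms
      simp: sec_local_closure sec_base_change char_sieve_base_change[OF P' \<phi> Q] morphism_in[OF \<phi>])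

text \<open>
  The first three conditions are stability properties of the relation for one sieve at a time; the
  axioms of a topology enter in the fourth, where they identify the closure with \<open>local_closure\<close>.
\<close>

lemma closure_property_F_dual:
  assumes J: "grothendieck_topology elts C J"
  shows "closure_property elts C (F_dual elts C J)"
proof -
  have F: "(Q, P) \<in> F_dual elts C J \<longleftrightarrow> embedding elts C Q P \<and>
      (\<forall>X D. (X, D) \<in> J \<longrightarrow> ((X, D), (Q, P)) \<in> duality elts C)" for Q P
    unfolding F_dual_def by (auto simp: subpresheaves_iff)
  have FI: "(Q, P) \<in> F_dual elts C J" if Q: "embedding elts C Q P"
    and *: "\<And>X D X' x p. (X, D) \<in> J \<Longrightarrow> x \<in> homset C X' X \<Longrightarrow> p \<in> sec P X' \<Longrightarrow>
      (\<And>Y y. y \<in> homset C Y X' \<Longrightarrow> cmp C x y \<in> sec D Y \<Longrightarrow> act P y p \<in> sec Q Y) \<Longrightarrow> p \<in> sec Q X'"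
    for Q P
  proof -
    have "((X, D), (Q, P)) \<in> duality elts C" if D: "(X, D) \<in> J" for X D
    proof -
      have "(X, D) \<in> sieves elts C" "(Q, P) \<in> subpresheaves elts C"
        using topologyD(1)[OF J] D Q by (auto simp: subpresheaves_iff)
      from duality_iff[OF this] show ?thesis using *[OF D] by blast
    qed
    with Q show ?thesis unfolding F by blast
  qed
  have "(P, P) \<in> F_dual elts C J" if "presheaf elts C P" for P
    using that by (intro FI embedding_refl)
  moreover have "(base_change C P' \<phi> Q, P') \<in> F_dual elts C J"
    if P': "presheaf elts C P'" and \<phi>: "presheaf_morphism C P' P \<phi>"
      and QP: "(Q, P) \<in> F_dual elts C J" for P' P \<phi> Q
  proof -
    have Q: "embedding elts C Q P" using QP unfolding F by blast
    show ?thesis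
    proof (rule FI)
      show "embedding elts C (base_change C P' \<phi> Q) P'" using P' \<phi> Q by (rule embedding_base_change)
      fix X D X' x p
      assume D: "(X, D) \<in> J" and x: "x \<in> homset C X' X" and p: "p \<in> sec P' X'"
        and *: "\<And>Y y. y \<in> homset C Y X' \<Longrightarrow> cmp C x y \<in> sec D Y \<Longrightarrow>
          act P' y p \<in> sec (base_change C P' \<phi> Q) Y"
      have X': "X' \<in> Ob C" using homset_Ob[OF x] by blast
      have dual: "((X, D), (Q, P)) \<in> duality elts C" using D QP unfolding F by blast
      have "\<phi> X' p \<in> sec Q X'"
      proof (rule dualityD[OF dual x morphism_in[OF \<phi> X' p]])
        fix Y y assume y: "y \<in> homset C Y X'" and "cmp C x y \<in> sec D Y"
        from *[OF this] show "act P y (\<phi> X' p) \<in> sec Q Y"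
          using homset_Ob[OF y] morphism_act[OF \<phi> y p] by (simp add: sec_base_change)
      qed
      with p X' show "p \<in> sec (base_change C P' \<phi> Q) X'" by (simp add: sec_base_change)
    qed
  qed
  moreover have "(intersection C P K Q, P) \<in> F_dual elts C J"
    if P: "presheaf elts C P" and Q: "\<forall>k\<in>K. (Q k, P) \<in> F_dual elts C J"
    for P and K :: "'v set" and Q
  proof (rule FI)
    show "embedding elts C (intersection C P K Q) P"
      using P Q unfolding F by (intro embedding_intersection) auto
    fix X D X' x p
    assume D: "(X, D) \<in> J" and x: "x \<in> homset C X' X" and p: "p \<in> sec P X'"
      and *: "\<And>Y y. y \<in> homset C Y X' \<Longrightarrow> cmp C x y \<in> sec D Y \<Longrightarrow>
        act P y p \<in> sec (intersection C P K Q) Y"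
    have X': "X' \<in> Ob C" using homset_Ob[OF x] by blast
    have "p \<in> sec (Q k) X'" if k: "k \<in> K" for k
    proof (rule dualityD[OF _ x p])
      show "((X, D), (Q k, P)) \<in> duality elts C" using D Q k unfolding F by blast
      fix Y y assume y: "y \<in> homset C Y X'" and "cmp C x y \<in> sec D Y"
      from *[OF this] show "act P y p \<in> sec (Q k) Y"
        using homset_Ob[OF y] k by (simp add: sec_intersection)
    qed
    with p X' show "p \<in> sec (intersection C P K Q) X'" by (simp add: sec_intersection)
  qed
  moreover have "closure_in elts C (F_dual elts C J) P' (base_change C P' \<phi> Q) =
      base_change C P' \<phi> (closure_in elts C (F_dual elts C J) P Q)"
    if P': "presheaf elts C P'" and \<phi>: "presheaf_morphism C P' P \<phi>" and Q: "embedding elts C Q P"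
    for P' P \<phi> Q
    using closure_in_eq[OF smallest_above_local_closure[OF J Q]]
      closure_in_eq[OF smallest_above_local_closure[OF J embedding_base_change[OF P' \<phi> Q]]]
      local_closure_base_change[OF J P' \<phi> Q] by simp
  ultimately show ?thesis unfolding closure_property_def by blast
qed

lemma closure_propertyD:
  assumes "closure_property elts C I"
  shows "presheaf elts C P \<Longrightarrow> (P, P) \<in> I"
    and "presheaf elts C P' \<Longrightarrow> presheaf elts C P \<Longrightarrow> presheaf_morphism C P' P \<phi> \<Longrightarrow>
      (Q, P) \<in> I \<Longrightarrow> (base_change C P' \<phi> Q, P') \<in> I"
    and "presheaf elts C P \<Longrightarrow> (\<And>k. k \<in> elts K \<Longrightarrow> (S k, P) \<in> I) \<Longrightarrow>
      (intersection C P (elts K) S, P) \<in> I"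
    and "presheaf elts C P' \<Longrightarrow> presheaf elts C P \<Longrightarrow> presheaf_morphism C P' P \<phi> \<Longrightarrow>
      embedding elts C Q P \<Longrightarrow> closure_in elts C I P' (base_change C P' \<phi> Q) =
        base_change C P' \<phi> (closure_in elts C I P Q)"
  using assms unfolding closure_property_def by simp_all

text \<open>
  The sub-presheaves in \<open>I\<close> above \<open>Q\<close> may form a proper class, whereas \<open>I\<close> is stable only under
  intersections of families indexed by a set. At a single object \<open>Z\<close>, one sub-presheaf for each
  section \<open>p \<in> P(Z)\<close>, chosen to omit \<open>p\<close> if that is possible, already has the least value at \<open>Z\<close>.
  Intersecting once more over representative objects gives least values at these objects, and the
  retractions carry this to all objects.
\<close>

lemma smallest_above_closure_in:
  assumes I: "I \<subseteq> subpresheaves elts C" and cl: "closure_property elts C I"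
    and Q: "embedding elts C Q P"
  shows "smallest_above elts C I P Q (closure_in elts C I P Q)"
proof -
  have P: "presheaf elts C P" using embedding_presheaf[OF Q] by blast
  define above where "above R \<longleftrightarrow> (R, P) \<in> I \<and> embedding elts C Q R" for R
  have above_P: "above P" using closure_propertyD(1)[OF cl P] Q by (simp add: above_def)
  have emb: "embedding elts C R P" if "above R" for R
    using that I by (auto simp: above_def subpresheaves_def)
  have above_Int: "above (intersection C P (elts K) S)"
    if S: "\<And>k. k \<in> elts K \<Longrightarrow> above (S k)" for K S
  proof -
    have "(intersection C P (elts K) S, P) \<in> I"
      using S by (intro closure_propertyD(3)[OF cl P]) (simp add: above_def)
    moreover have Int: "embedding elts C (intersection C P (elts K) S) P"
      using P emb[OF S] by (rule embedding_intersection)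
    have "sec Q X \<subseteq> sec (S k) X" if "X \<in> Ob C" "k \<in> elts K" for X k
      using S[OF that(2)] embedding_sec[of Q "S k" X] that(1) by (auto simp: above_def)
    then have "embedding elts C Q (intersection C P (elts K) S)"
      using embedding_sec[OF Q]
      by (auto simp: embedding_iff_sec_subset[OF Q Int] sec_intersection)
    ultimately show ?thesis by (simp add: above_def)
  qed
  have least_at: "\<exists>S. above S \<and> (\<forall>R. above R \<longrightarrow> sec S Z \<subseteq> sec R Z)" if Z: "Z \<in> Ob C" for Z
  proof -
    obtain K where K: "elts K = sec P Z"
      using P Z by (auto simp: presheaf_def small_def dest!: PiE_mem)
    have "\<exists>S. above S \<and> ((\<exists>R. above R \<and> p \<notin> sec R Z) \<longrightarrow> p \<notin> sec S Z)" for p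
      using above_P by blast
    then obtain S where S: "\<And>p. above (S p)"
      "\<And>p R. above R \<Longrightarrow> p \<notin> sec R Z \<Longrightarrow> p \<notin> sec (S p) Z"
      by metis
    have "above (intersection C P (elts K) S)" using S(1) by (rule above_Int)
    moreover have "sec (intersection C P (elts K) S) Z \<subseteq> sec R Z" if "above R" for R
      using S(2)[OF that] K Z by (auto simp: sec_intersection)
    ultimately show ?thesis by blast
  qed
  have "\<exists>S. above S \<and> (Z \<in> Ob C \<longrightarrow> (\<forall>R. above R \<longrightarrow> sec S Z \<subseteq> sec R Z))" for Z
    using least_at above_P by blast
  then obtain S where S: "\<And>Z. above (S Z)"
    "\<And>Z R. Z \<in> Ob C \<Longrightarrow> above R \<Longrightarrow> sec (S Z) Z \<subseteq> sec R Z"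
    by metis
  obtain K F where KF: "\<forall>X\<in>Ob C. \<exists>k\<in>elts K. \<exists>s\<in>homset C X (F k). \<exists>r\<in>homset C (F k) X.
      cmp C r s = ident C X"
    using small_retracts by blast
  let ?M = "intersection C P (elts K) (\<lambda>k. S (F k))"
  have M: "above ?M" using S(1) by (intro above_Int)
  have least: "embedding elts C ?M R" if R: "above R" for R
  proof -
    have "p \<in> sec R X" if X: "X \<in> Ob C" and p: "p \<in> sec ?M X" for X p
    proof -
      obtain k s r where k: "k \<in> elts K" and s: "s \<in> homset C X (F k)" and r: "r \<in> homset C (F k) X"
        and rs: "cmp C r s = ident C X"
        using KF X by blast
      have Fk: "F k \<in> Ob C" using homset_Ob[OF s] by blast
      have pP: "p \<in> sec P X" using embedding_sec[OF emb[OF M] X p] .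
      have "act P r p \<in> sec ?M (F k)" using embedding_act[OF emb[OF M] r p] .
      then have "act P r p \<in> sec (S (F k)) (F k)"
        using k Fk by (simp add: sec_intersection)
      then have "act P r p \<in> sec R (F k)" using S(2)[OF Fk R] by blast
      then have "act P s (act P r p) \<in> sec R X" using embedding_act[OF emb[OF R] s] by blast
      then show ?thesis using act_cmp[OF P s r pP] rs act_ident[OF P X pP] by simp
    qed
    then show ?thesis using embedding_iff_sec_subset[OF emb[OF M] emb[OF R]] by blast
  qed
  have "smallest_above elts C I P Q ?M"
    using M least unfolding smallest_above_def above_def by blast
  with closure_in_eq show ?thesis by metis
qed

text \<open>
  The sieve of those \<open>x\<close> that send a section of the closure of \<open>Q\<close> into \<open>Q\<close> is dense for \<open>I\<close>, and so
  are its pullbacks; hence it lies in \<open>G(I)\<close>, and an element of \<open>F(G(I))\<close> equals its closure.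
\<close>

lemma F_dual_G_dual_closure_property:
  assumes I: "I \<subseteq> subpresheaves elts C" and cl: "closure_property elts C I"
  shows "F_dual elts C (G_dual elts C I) = I"
proof
  show "I \<subseteq> F_dual elts C (G_dual elts C I)"
    using I by (auto simp: F_dual_def G_dual_def)
  show "F_dual elts C (G_dual elts C I) \<subseteq> I"
  proof clarify
    fix Q P assume QP: "(Q, P) \<in> F_dual elts C (G_dual elts C I)"
    then have Q: "embedding elts C Q P" by (simp add: F_dual_def subpresheaves_iff)
    have P: "presheaf elts C P" using embedding_presheaf[OF Q] by blast
    let ?R = "closure_in elts C I P Q"
    have "smallest_above elts C I P Q ?R"
      using smallest_above_closure_in[OF I cl Q] .
    then have RI: "(?R, P) \<in> I" and QR: "embedding elts C Q ?R" by (auto simp: smallest_above_def)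
    have R: "embedding elts C ?R P" using RI I subpresheaves_iff by blast
    have "p \<in> sec Q X" if X: "X \<in> Ob C" and pR: "p \<in> sec ?R X" for X p
    proof -
      have p: "p \<in> sec P X" using embedding_sec[OF R X pR] .
      let ?D = "char_sieve P Q X p"
      have D: "(X, ?D) \<in> sieves elts C"
        using embedding_char_sieve[OF Q X p] X by (simp add: sieves_iff)
      \<comment> \<open>Taking the closure commutes with base change along the morphism that corresponds to \<open>P(y)(p)\<close>.\<close>
      have dense: "closure_in elts C I (yoneda C Y) (sieve_pullback C y ?D) = yoneda C Y"
        if y: "y \<in> homset C Y X" for Y y
      proof -
        have Y: "Y \<in> Ob C" using homset_Ob[OF y] by blast
        have yp: "act P y p \<in> sec P Y" using act_in[OF P y p] .
        have "closure_in elts C I (yoneda C Y) (char_sieve P Q Y (act P y p)) =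
            char_sieve P ?R Y (act P y p)"
          unfolding char_sieve_def
          by (rule closure_propertyD(4)[OF cl presheaf_yoneda[OF Y] P
                presheaf_morphism_section_map[OF P yp] Q])
        also have "\<dots> = yoneda C Y"
          using char_sieve_member[OF R Y yp] embedding_act[OF R y pR] by blast
        finally show ?thesis by (simp add: sieve_pullback_char_sieve[OF Q y p])
      qed
      have "((X, ?D), (Q', P')) \<in> duality elts C" if Q'I: "(Q', P') \<in> I" for Q' P'
      proof -
        have QP': "(Q', P') \<in> subpresheaves elts C" using I Q'I by blast
        then have Q': "embedding elts C Q' P'" by (simp add: subpresheaves_iff)
        have P': "presheaf elts C P'" using embedding_presheaf[OF Q'] by blast
        show ?thesis unfolding duality_iff[OF D QP']
        proof (intro allI impI, elim conjE)
          fix Y y p'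
          assume y: "y \<in> homset C Y X" and p': "p' \<in> sec P' Y"
            and *: "\<forall>Z z. z \<in> homset C Z Y \<and> cmp C y z \<in> sec ?D Z \<longrightarrow> act P' z p' \<in> sec Q' Z"
          have Y: "Y \<in> Ob C" using homset_Ob[OF y] by blast
          let ?E = "sieve_pullback C y ?D" and ?E' = "char_sieve P' Q' Y p'"
          have E: "embedding elts C ?E (yoneda C Y)"
            using D embedding_sieve_pullback[OF y] by (simp add: sieves_iff)
          have E': "embedding elts C ?E' (yoneda C Y)" using embedding_char_sieve[OF Q' Y p'] .
          have "(?E', yoneda C Y) \<in> I"
            unfolding char_sieve_def
            by (rule closure_propertyD(2)[OF cl presheaf_yoneda[OF Y] P'
                  presheaf_morphism_section_map[OF P' p'] Q'I])
          moreover have "embedding elts C ?E ?E'"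
            using * by (auto simp: embedding_iff_sec_subset[OF E E'] sec_sieve_pullback[OF y]
                sec_char_sieve)
          ultimately have "embedding elts C (yoneda C Y) ?E'"
            using smallest_above_closure_in[OF I cl E]
            unfolding smallest_above_def dense[OF y] by blast
          with E' have "?E' = yoneda C Y" by (rule embedding_antisym)
          then show "p' \<in> sec Q' Y" using char_sieve_member[OF Q' Y p'] by blast
        qed
      qed
      with D have "(X, ?D) \<in> G_dual elts C I" by (auto simp: G_dual_def)
      then have dual: "((X, ?D), (Q, P)) \<in> duality elts C" using QP by (auto simp: F_dual_def)
      show ?thesis
      proof (rule dualityD[OF dual ident_in[OF X] p])
        fix Y y assume y: "y \<in> homset C Y X" and "cmp C (ident C X) y \<in> sec ?D Y"
        then show "act P y p \<in> sec Q Y"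
          using homset_Ob[OF y] by (simp add: cmp_ident_left sec_char_sieve)
      qed
    qed
    then have "embedding elts C ?R Q" using embedding_iff_sec_subset[OF R Q] by blast
    with QR have "?R = Q" by (blast intro: embedding_antisym)
    with RI show "(Q, P) \<in> I" by simp
  qed
qed

end


section \<open>Essentially small categories\<close>

text \<open>
  By naturality of \<open>\<epsilon> : F G \<rightarrow> id\<close>, a morphism \<open>f\<close> of \<open>C\<close> is recovered from \<open>G(f)\<close> by conjugating
  \<open>F(G(f))\<close> with \<open>\<epsilon>\<close>. So the hom-set is contained in the image of a set, and every object \<open>X\<close> is
  isomorphic, by \<open>\<epsilon>\<close>, to the value of \<open>F\<close> at the object \<open>G(X)\<close> of a small category.
\<close>

lemma presheaf_universe_if_essentially_small:
  fixes elts :: "'v \<Rightarrow> 'v set" and C :: "('o, 'v) category_data"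
  assumes "universe elts" and "essentially_small_category elts C"
  shows "presheaf_universe elts C"
proof -
  interpret universe elts by fact
  interpret category C using assms(2) by (simp add: essentially_small_category_def)
  obtain D :: "('v, 'v) category_data" and F G \<eta> \<epsilon> where D: "category D"
    and small: "small elts (Ob D)" "small elts (Ar D)"
    and F: "is_functor D C F" and G: "is_functor C D G"
    and \<epsilon>: "natural_isomorphism C C (functor_comp F G) functor_id \<epsilon>"
    using assms(2) unfolding essentially_small_category_def equivalent_categories_def by blast
  have "\<exists>g\<in>homset C X (omap F (omap G X)). \<epsilon> X \<in> homset C (omap F (omap G X)) X \<and>
      cmp C g (\<epsilon> X) = ident C (omap F (omap G X)) \<and> cmp C (\<epsilon> X) g = ident C X" if "X \<in> Ob C" for X
    using \<epsilon> that
    unfolding natural_isomorphism_def isomorphism_def functor_comp_def functor_id_def by auto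
  then obtain \<delta> where \<delta>: "\<And>X. X \<in> Ob C \<Longrightarrow> \<delta> X \<in> homset C X (omap F (omap G X))"
    "\<And>X. X \<in> Ob C \<Longrightarrow> \<epsilon> X \<in> homset C (omap F (omap G X)) X"
    "\<And>X. X \<in> Ob C \<Longrightarrow> cmp C (\<epsilon> X) (\<delta> X) = ident C X"
    by metis
  show ?thesis
  proof
    fix X Y assume X: "X \<in> Ob C" and Y: "Y \<in> Ob C"
    let ?h = "\<lambda>g. cmp C (cmp C (\<epsilon> Y) (amap F g)) (\<delta> X)"
    obtain a where a: "elts a = Ar D" using small by (auto simp: small_def)
    have "homset C X Y \<subseteq> ?h ` Ar D"
    proof
      fix f assume f: "f \<in> homset C X Y"
      then have Ar: "f \<in> Ar C" "src C f = X" "tgt C f = Y" by (auto simp: homset_def)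
      have Gf: "amap G f \<in> Ar D"
        using G Ar unfolding is_functor_def homset_def by blast
      have "cmp C (\<epsilon> Y) (amap F (amap G f)) = cmp C f (\<epsilon> X)"
        using \<epsilon> Ar unfolding natural_isomorphism_def functor_comp_def functor_id_def by auto
      then have "?h (amap G f) = cmp C (cmp C f (\<epsilon> X)) (\<delta> X)" by simp
      also have "\<dots> = f"
        using cmp_assoc[OF \<delta>(1)[OF X] \<delta>(2)[OF X] f] \<delta>(3)[OF X] cmp_ident_right[OF f] by simp
      finally show "f \<in> ?h ` Ar D" using Gf by (metis image_eqI)
    qed
    moreover obtain b where "elts b = ?h ` Ar D" using replacement[of ?h a] a by auto
    ultimately show "small elts (homset C X Y)" using separation unfolding small_def by metis
  next
    obtain K where K: "elts K = Ob D" using small by (auto simp: small_def)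
    have "omap G X \<in> elts K" if "X \<in> Ob C" for X
      using G that K unfolding is_functor_def by blast
    then show "\<exists>K F. \<forall>X\<in>Ob C. \<exists>k\<in>elts K. \<exists>s\<in>homset C X (F k). \<exists>r\<in>homset C (F k) X.
        cmp C r s = ident C X"
      using \<delta> by metis
  qed
qed

theorem mainTheorem7:
  fixes elts :: "'v \<Rightarrow> 'v set" and C :: "('o, 'v) category_data"
  assumes "universe elts" and "essentially_small_category elts C"
  shows "(\<forall>J \<subseteq> sieves elts C.
            G_dual elts C (F_dual elts C J) = J \<longleftrightarrow> grothendieck_topology elts C J) \<and>
         (\<forall>I \<subseteq> subpresheaves elts C.
            F_dual elts C (G_dual elts C I) = I \<longleftrightarrow> closure_property elts C I)"
proof -
  interpret presheaf_universe elts C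
    using assms by (rule presheaf_universe_if_essentially_small)
  have "F_dual elts C J \<subseteq> subpresheaves elts C" for J by (auto simp: F_dual_def)
  then have topology: "grothendieck_topology elts C (G_dual elts C (F_dual elts C J))" for J
    by (rule grothendieck_topology_G_dual)
  have closure: "closure_property elts C (F_dual elts C (G_dual elts C I))"
    if "I \<subseteq> subpresheaves elts C" for I
    using that by (intro closure_property_F_dual grothendieck_topology_G_dual)
  show ?thesis
    using topology closure G_dual_F_dual_topology F_dual_G_dual_closure_property by metis
qed

end
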